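(* Let $V$ be a vector space over $\mathbb{R}$ endowed with a norm $\|\cdot\|$, with dual space $V^*$, and suppose that $\mu$ is a Borel measure on $V^*$ such that $$\|x\|=\int_{V^*}|x\ell|\,\mu(\mathrm{d}\ell)\quad\text{for all }x\in V.$$ Let $X$ be any random vector in $V$. Then $$\mathsf{E}\|X\|=\frac2\pi\int_{V^*\times(0,\infty)}\frac{1-\Re\,\mathsf{E}e^{itX\ell}}{t^2}\,\mu(\mathrm{d}\ell)\,\mathrm{d}t.$$
   Context: For $x\in V$ and $\ell\in V^*$, $x\ell$ denotes the value of the linear functional $\ell$ at $x$. $\mathsf{E}$ denotes expectation and $\Re$ the real part. *)

theory Defs
  imports "HOL-Probability.Probability"
begin

text \<open>
  A random vector in a normed space is a strongly measurable map: Borel measurable and almost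
  surely with values in a separable set. On a separable space this is plain Borel measurability
  (see the lemma below). Without almost sure separability, Tonelli's theorem may fail for
  \<open>(\<omega>, l) \<mapsto> l (X \<omega>)\<close>: if the power set of \<open>\<Gamma>\<close> carries an atomless probability measure (a
  real-valued measurable cardinal), the random basis vector of \<open>l\<^sup>1(\<Gamma>)\<close> is Borel measurable, has
  norm 1, and all its coordinates vanish almost surely.
\<close>
definition random_vector :: "'w measure \<Rightarrow> ('w \<Rightarrow> 'v::real_normed_vector) \<Rightarrow> bool" where
  "random_vector M X \<longleftrightarrow>
     X \<in> borel_measurable M \<and> (\<exists>S. countable S \<and> (AE \<omega> in M. X \<omega> \<in> closure S))"

lemma random_vector_iff_borel_measurable:
  fixes X :: "'w \<Rightarrow> 'v::{real_normed_vector, second_countable_topology}"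
  shows "random_vector M X \<longleftrightarrow> X \<in> borel_measurable M"
proof -
  obtain S :: "'v set" where S: "countable S"
      "\<And>U. open U \<Longrightarrow> U \<noteq> {} \<Longrightarrow> \<exists>d\<in>S. d \<in> U"
    using countable_dense_setE by blast
  have "x \<in> closure S" for x
    using S(2) by (subst closure_iff_nhds_not_empty) blast
  with S(1) show ?thesis
    unfolding random_vector_def by auto
qed

end

theory Submission
  imports Defs
begin

text \<open>
  The scalar identity \<open>\<bar>u\<bar> = 2/\<pi> \<integral>\<^sub>0\<^sup>\<infinity> (1 - cos (t u)) / t\<^sup>2 dt\<close> (lemma
  \<open>nn_integral_one_minus_cos_over_square\<close>), applied to \<open>u = l (X \<omega>)\<close>, turns
  \<open>\<parallel>X \<omega>\<parallel> = \<integral> \<bar>l (X \<omega>)\<bar> d\<mu>(l)\<close> into a double integral over \<open>(l, t)\<close>. Taking the expectation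
  and moving it inside gives the claim, because \<open>E (1 - cos (t l(X))) = 1 - Re E exp (i t l(X))\<close>.
  Everything is nonnegative, so only the hypotheses of Tonelli's theorem need care, and there are
  two obstacles.

  \<^item> The dual space is in general not separable, so the evaluation \<open>(x, l) \<mapsto> l x\<close>, although
    continuous, need not be measurable for the product of the Borel \<sigma>-algebras. Since \<open>X\<close> has
    essentially separable range, it is a limit of countably valued maps, and this makes
    \<open>(\<omega>, l) \<mapsto> l (X \<omega>)\<close> jointly measurable (lemma \<open>borel_measurable_pairing\<close>).

  \<^item> The measure \<open>\<mu>\<close> need not be \<sigma>-finite. For instance, it may have infinite mass at \<open>0\<close>. But
    the functionals that do not vanish on a given countable set \<open>{s\<^sub>0, s\<^sub>1, \<dots>}\<close> are covered by the
    sets \<open>{l. \<bar>l s\<^sub>k\<bar> \<ge> 1/n}\<close>, whose measure is at most \<open>n \<parallel>s\<^sub>k\<parallel>\<close>. All other functionals vanish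
    on the closure, hence at \<open>X\<close>, and contribute nothing to either side
    (lemma \<open>nn_integral_norm_eq_iterated\<close>).
\<close>

section \<open>The absolute value as an integral of cosines\<close>

text \<open>
  Integration by parts reduces the integral to the Dirichlet integral: on \<open>t > 0\<close> the integrand
  has the antiderivative \<open>a Si(a t) - (1 - cos (a t)) / t\<close>, which tends to \<open>0\<close> at \<open>0\<close> and to
  \<open>a \<pi>/2\<close> at infinity.
\<close>
lemma nn_integral_one_minus_cos_over_square_pos:
  fixes a :: real
  assumes a: "0 < a"
  shows "(\<integral>\<^sup>+t. ennreal ((1 - cos (t * a)) / t\<^sup>2) \<partial>restrict_space lborel {0<..})
         = ennreal (a * (pi / 2))"
proof -
  define F where "F t = a * Si (a * t) - (1 - cos (t * a)) / t" for t
  define f where "f t = (1 - cos (t * a)) / t\<^sup>2" for t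
  have einterval: "einterval 0 \<infinity> = {0::real<..}"
    by (auto simp: einterval_def)
  have deriv: "DERIV F t :> f t" if "0 < t" for t
  proof -
    have "((\<lambda>t. Si (a * t)) has_real_derivative sinc (a * t) * a) (at t)"
      by (rule DERIV_chain2[OF DERIV_Si]) (auto intro!: derivative_eq_intros)
    from this have "(F has_real_derivative
        a * (sinc (a * t) * a) - (sin (t * a) * a * t - (1 - cos (t * a))) / (t * t)) (at t)"
      unfolding F_def using that by (auto intro!: derivative_eq_intros)
    moreover have "a * (sinc (a * t) * a) - (sin (t * a) * a * t - (1 - cos (t * a))) / (t * t) = f t"
      using that a by (simp add: f_def field_simps power2_eq_square)
    ultimately show ?thesis by simp
  qed
  have cont: "isCont f t" if "0 < t" for t
    unfolding f_def using that by (auto intro!: continuous_intros)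
  have lim0: "(F \<longlongrightarrow> 0) (at_right 0)"
  proof -
    have "((\<lambda>t. Si (a * t)) \<longlongrightarrow> Si (a * 0)) (at_right 0)"
      by (intro isCont_tendsto_compose[OF isCont_Si] tendsto_intros)
    moreover have "Si 0 = 0"
      by (simp add: Si_def zero_ereal_def)
    moreover have "((\<lambda>t. (1 - cos (t * a)) / t) \<longlongrightarrow> 0) (at_right 0)"
    proof -
      have "DERIV (\<lambda>t. 1 - cos (t * a)) 0 :> 0"
        by (auto intro!: derivative_eq_intros)
      then have "((\<lambda>t. (1 - cos (t * a)) / t) \<longlongrightarrow> 0) (at 0)"
        by (simp add: has_field_derivative_iff)
      then show ?thesis
        by (rule filterlim_mono[OF _ order_refl at_le]) simp
    qed
    ultimately have "(F \<longlongrightarrow> a * 0 - 0) (at_right 0)"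
      unfolding F_def by (intro tendsto_intros) simp_all
    then show ?thesis by simp
  qed
  have lim_top: "(F \<longlongrightarrow> a * (pi / 2)) at_top"
  proof -
    have "filterlim (\<lambda>t. a * t) at_top at_top"
      using a by (intro filterlim_tendsto_pos_mult_at_top[OF tendsto_const] filterlim_ident)
    then have "((\<lambda>t. Si (a * t)) \<longlongrightarrow> pi / 2) at_top"
      by (rule filterlim_compose[OF Si_at_top])
    moreover have "((\<lambda>t. (1 - cos (t * a)) / t) \<longlongrightarrow> 0) at_top"
    proof (rule Lim_null_comparison)
      have "norm ((1 - cos (t * a)) / t) \<le> 2 / t" if "0 < t" for t
        using that cos_le_one[of "t * a"] cos_ge_minus_one[of "t * a"]
        by (auto simp: abs_le_iff intro!: divide_right_mono)
      then show "\<forall>\<^sub>F t in at_top. norm ((1 - cos (t * a)) / t) \<le> 2 / t"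
        by (intro eventually_mono[OF eventually_gt_at_top[of 0]])
      show "((\<lambda>t::real. 2 / t) \<longlongrightarrow> 0) at_top"
        by (intro tendsto_divide_0[OF tendsto_const] filterlim_at_top_imp_at_infinity filterlim_ident)
    qed
    ultimately have "(F \<longlongrightarrow> a * (pi / 2) - 0) at_top"
      unfolding F_def by (intro tendsto_intros)
    then show ?thesis by simp
  qed
  have nonneg: "0 \<le> f t" for t
    by (simp add: f_def)
  have lim0': "((F \<circ> real_of_ereal) \<longlongrightarrow> 0) (at_right 0)"
    using lim0 by (simp add: zero_ereal_def ereal_tendsto_simps1 del: ereal_eq_0)
  have lim_top': "((F \<circ> real_of_ereal) \<longlongrightarrow> a * (pi / 2)) (at_left \<infinity>)"
    using lim_top by (simp add: ereal_tendsto_simps1)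
  have integrable: "set_integrable lborel (einterval 0 \<infinity>) f"
    and integral: "(LBINT t=0..\<infinity>. f t) = a * (pi / 2) - 0"
    using deriv cont nonneg
    by (intro interval_integral_FTC_nonneg[OF _ _ _ _ lim0' lim_top']; simp)+
  have "(\<integral>\<^sup>+t. ennreal (f t) \<partial>restrict_space lborel {0<..})
      = (\<integral>\<^sup>+t. ennreal (indicator {0<..} t *\<^sub>R f t) \<partial>lborel)"
    by (subst nn_integral_restrict_space) (auto intro!: nn_integral_cong simp: indicator_def)
  also have "\<dots> = ennreal (\<integral>t. indicator {0<..} t *\<^sub>R f t \<partial>lborel)"
    using integrable unfolding einterval set_integrable_def
    by (intro nn_integral_eq_integral) (auto simp: nonneg)
  also have "(\<integral>t. indicator {0<..} t *\<^sub>R f t \<partial>lborel) = a * (pi / 2)"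
    using integral
    by (simp add: interval_lebesgue_integral_def set_lebesgue_integral_def einterval zero_ereal_def)
  finally show ?thesis
    by (simp add: f_def)
qed

lemma nn_integral_one_minus_cos_over_square:
  fixes u :: real
  shows "ennreal \<bar>u\<bar> = ennreal (2 / pi) *
           (\<integral>\<^sup>+t. ennreal ((1 - cos (t * u)) / t\<^sup>2) \<partial>restrict_space lborel {0<..})"
proof (cases "u = 0")
  case False
  have cos_abs: "cos (t * u) = cos (t * \<bar>u\<bar>)" for t
    by (simp add: abs_if)
  show ?thesis
    using False nn_integral_one_minus_cos_over_square_pos[of "\<bar>u\<bar>"]
    by (simp add: cos_abs ennreal_mult[symmetric])
qed simp

section \<open>Tonelli's theorem for the pairing of a random vector with functionals\<close>

lemma borel_measurable_blinfun_eval: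
  assumes "sets \<mu> = sets borel"
  shows "(\<lambda>l :: 'v::real_normed_vector \<Rightarrow>\<^sub>L real. blinfun_apply l x) \<in> borel_measurable \<mu>"
  unfolding measurable_cong_sets[OF assms refl]
  by (intro borel_measurable_continuous_onI continuous_intros)

lemma borel_measurable_blinfun_apply:
  fixes l :: "'v::real_normed_vector \<Rightarrow>\<^sub>L real"
  shows "blinfun_apply l \<in> borel_measurable borel"
  by (intro borel_measurable_continuous_onI continuous_intros)

text \<open>
  Choosing the first \<open>s k\<close> within distance \<open>1/(n+1)\<close> of \<open>X \<omega>\<close> approximates \<open>X\<close> by countably
  valued measurable maps. For these the pairing is jointly measurable, since it is so on each of
  the countably many pieces, and it converges pointwise because functionals are continuous.
\<close>
lemma borel_measurable_pairing:
  fixes X :: "'w \<Rightarrow> 'v::real_normed_vector" and \<mu> :: "('v \<Rightarrow>\<^sub>L real) measure"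
  assumes \<mu>: "sets \<mu> = sets borel"
    and X[measurable]: "X \<in> borel_measurable M"
    and range_X: "\<And>\<omega>. \<omega> \<in> space M \<Longrightarrow> X \<omega> \<in> closure (range (s :: nat \<Rightarrow> 'v))"
  shows "(\<lambda>(\<omega>, l). blinfun_apply l (X \<omega>)) \<in> borel_measurable (M \<Otimes>\<^sub>M \<mu>)"
proof -
  define K where "K n \<omega> = (LEAST k. dist (X \<omega>) (s k) < inverse (real (Suc n)))" for n \<omega>
  have dist_meas[measurable]: "(\<lambda>\<omega>. dist (X \<omega>) y) \<in> borel_measurable M" for y
    by (intro measurable_compose[OF X] borel_measurable_continuous_onI continuous_intros)
  have K_meas: "K n \<in> measurable M (count_space UNIV)" for n
    unfolding K_def by measurable
  have K_dist: "dist (X \<omega>) (s (K n \<omega>)) < inverse (real (Suc n))" if "\<omega> \<in> space M" for n \<omega>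
  proof -
    have "\<exists>k. dist (X \<omega>) (s k) < inverse (real (Suc n))"
      using range_X[OF that] unfolding closure_approachable
      by (auto simp: dist_commute dest!: spec[of _ "inverse (real (Suc n))"])
    then show ?thesis
      unfolding K_def by (rule LeastI_ex)
  qed
  have approx: "(\<lambda>n. s (K n \<omega>)) \<longlonglongrightarrow> X \<omega>" if "\<omega> \<in> space M" for \<omega>
  proof (rule metric_tendsto_imp_tendsto[OF LIMSEQ_inverse_real_of_nat])
    show "\<forall>\<^sub>F n in sequentially. dist (s (K n \<omega>)) (X \<omega>) \<le> dist (inverse (real (Suc n))) 0"
      using K_dist[OF that] by (auto simp: dist_commute intro!: always_eventually less_imp_le)
  qed
  show ?thesis
  proof (rule borel_measurable_LIMSEQ_metric)
    show "(\<lambda>p. blinfun_apply (snd p) (s (K n (fst p)))) \<in> borel_measurable (M \<Otimes>\<^sub>M \<mu>)" for n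
    proof (rule measurable_compose_countable)
      show "(\<lambda>p. blinfun_apply (snd p) (s k)) \<in> borel_measurable (M \<Otimes>\<^sub>M \<mu>)" for k
        by (rule measurable_compose[OF measurable_snd borel_measurable_blinfun_eval[OF \<mu>]])
      show "(\<lambda>p. K n (fst p)) \<in> measurable (M \<Otimes>\<^sub>M \<mu>) (count_space UNIV)"
        by (rule measurable_compose[OF measurable_fst K_meas])
    qed
    show "(\<lambda>n. blinfun_apply (snd p) (s (K n (fst p)))) \<longlonglongrightarrow> (case p of (\<omega>, l) \<Rightarrow> blinfun_apply l (X \<omega>))"
      if "p \<in> space (M \<Otimes>\<^sub>M \<mu>)" for p
      using that approx[of "fst p"]
      by (auto simp: space_pair_measure intro!: tendsto_intros)
  qed
qed

text \<open>
  Markov's inequality for \<open>l \<mapsto> \<bar>l (s k)\<bar>\<close>, whose integral is \<open>\<parallel>s k\<parallel> < \<infinity>\<close>, bounds the measure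
  of each set \<open>{l. \<bar>l (s k)\<bar> \<ge> 1/(n+1)}\<close>.
\<close>
lemma sigma_finite_nonvanishing_functionals:
  fixes \<mu> :: "('v::real_normed_vector \<Rightarrow>\<^sub>L real) measure" and s :: "nat \<Rightarrow> 'v"
  assumes \<mu>: "sets \<mu> = sets borel"
    and norm: "\<And>x. ennreal (norm x) = (\<integral>\<^sup>+ l. ennreal \<bar>blinfun_apply l x\<bar> \<partial>\<mu>)"
  shows "sigma_finite_measure
           (density \<mu> (indicator {l \<in> space \<mu>. \<exists>k. blinfun_apply l (s k) \<noteq> 0}))"
proof -
  define A where "A = {l \<in> space \<mu>. \<exists>k. blinfun_apply l (s k) \<noteq> 0}"
  define B where "B k n = {l \<in> space \<mu>. inverse (real (Suc n)) \<le> \<bar>blinfun_apply l (s k)\<bar>}" for k n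
  note [measurable] = borel_measurable_blinfun_eval[OF \<mu>]
  have A[measurable]: "A \<in> sets \<mu>"
    unfolding A_def by measurable
  have B[measurable]: "B k n \<in> sets \<mu>" for k n
    unfolding B_def by measurable
  have cover: "A \<subseteq> (\<Union>k n. B k n)"
  proof
    fix l assume "l \<in> A"
    then obtain k where k: "l \<in> space \<mu>" "0 < \<bar>blinfun_apply l (s k)\<bar>"
      by (auto simp: A_def)
    then obtain n where "inverse (real (Suc n)) < \<bar>blinfun_apply l (s k)\<bar>"
      using reals_Archimedean by blast
    with k show "l \<in> (\<Union>k n. B k n)"
      by (auto simp: B_def intro: less_imp_le)
  qed
  have B_finite: "emeasure \<mu> (B k n) < \<infinity>" for k n
  proof -
    have "inverse (real (Suc n)) \<le> y \<longleftrightarrow> 1 \<le> ennreal (real (Suc n)) * ennreal y" if "0 \<le> y" for y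
    proof -
      have "1 \<le> ennreal (real (Suc n)) * ennreal y \<longleftrightarrow> ennreal 1 \<le> ennreal (real (Suc n) * y)"
        using that by (simp only: ennreal_mult of_nat_0_le_iff ennreal_1)
      also have "\<dots> \<longleftrightarrow> inverse (real (Suc n)) \<le> y"
        using that by (subst ennreal_le_iff) (auto simp: field_simps)
      finally show ?thesis by simp
    qed
    then have "emeasure \<mu> (B k n) = emeasure \<mu> ({l \<in> space \<mu>. 1 \<le> ennreal (real (Suc n)) * ennreal \<bar>blinfun_apply l (s k)\<bar>})"
      unfolding B_def by (metis abs_ge_zero)
    also have "\<dots> \<le> ennreal (real (Suc n)) * (\<integral>\<^sup>+ l. ennreal \<bar>blinfun_apply l (s k)\<bar> * indicator (space \<mu>) l \<partial>\<mu>)"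
      by (intro nn_integral_Markov_inequality) auto
    also have "(\<integral>\<^sup>+ l. ennreal \<bar>blinfun_apply l (s k)\<bar> * indicator (space \<mu>) l \<partial>\<mu>) = ennreal (norm (s k))"
      unfolding norm by (intro nn_integral_cong) simp
    finally show ?thesis
      by (rule order_le_less_trans) (simp add: ennreal_mult_less_top)
  qed
  let ?\<nu> = "density \<mu> (indicator A)"
  have "sigma_finite_measure ?\<nu>"
  proof
    \<comment> \<open>The complement of \<open>A\<close> is null for the restricted measure, so it may join the cover.\<close>
    let ?C = "insert (space \<mu> - A) (range (\<lambda>(k, n). B k n))"
    have "emeasure ?\<nu> (B k n) \<noteq> \<infinity>" for k n
    proof -
      have "emeasure ?\<nu> (B k n) = (\<integral>\<^sup>+ l. indicator A l * indicator (B k n) l \<partial>\<mu>)"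
        by (rule emeasure_density) auto
      also have "\<dots> \<le> (\<integral>\<^sup>+ l. indicator (B k n) l \<partial>\<mu>)"
        by (intro nn_integral_mono) (simp split: split_indicator)
      also have "\<dots> = emeasure \<mu> (B k n)"
        by simp
      finally show ?thesis
        using B_finite[of k n] by auto
    qed
    moreover have "emeasure ?\<nu> (space \<mu> - A) = 0"
      by (auto simp: emeasure_density intro!: nn_integral_zero' split: split_indicator)
    moreover have "\<Union>?C = space \<mu>"
      using cover by (auto simp: A_def B_def)
    ultimately show "\<exists>C. countable C \<and> C \<subseteq> sets ?\<nu> \<and> \<Union>C = space ?\<nu> \<and> (\<forall>a\<in>C. emeasure ?\<nu> a \<noteq> \<infinity>)"
      by (intro exI[of _ ?C]) auto
  qed
  then show ?thesis
    by (simp add: A_def)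
qed

text \<open>
  The exchange of integrals is Tonelli's theorem for the \<sigma>-finite part of \<open>\<mu>\<close> from
  the previous lemma: a functional that vanishes at all \<open>s k\<close> vanishes on their closure.
\<close>
lemma nn_integral_norm_eq_iterated:
  fixes X :: "'w \<Rightarrow> 'v::real_normed_vector" and \<mu> :: "('v \<Rightarrow>\<^sub>L real) measure"
  assumes \<mu>: "sets \<mu> = sets borel"
    and norm: "\<And>x. ennreal (norm x) = (\<integral>\<^sup>+ l. ennreal \<bar>blinfun_apply l x\<bar> \<partial>\<mu>)"
    and M: "sigma_finite_measure M"
    and X: "X \<in> borel_measurable M"
    and range_X: "\<And>\<omega>. \<omega> \<in> space M \<Longrightarrow> X \<omega> \<in> closure (range (s :: nat \<Rightarrow> 'v))"
  shows "(\<integral>\<^sup>+ \<omega>. ennreal (norm (X \<omega>)) \<partial>M) = (\<integral>\<^sup>+ l. (\<integral>\<^sup>+ \<omega>. ennreal \<bar>blinfun_apply l (X \<omega>)\<bar> \<partial>M) \<partial>\<mu>)"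
proof -
  define A where "A = {l \<in> space \<mu>. \<exists>k. blinfun_apply l (s k) \<noteq> 0}"
  let ?\<nu> = "density \<mu> (indicator A)"
  interpret M: sigma_finite_measure M by (rule M)
  interpret \<nu>: sigma_finite_measure ?\<nu>
    unfolding A_def by (rule sigma_finite_nonvanishing_functionals[OF \<mu> norm])
  interpret pair_sigma_finite M ?\<nu> ..
  note [measurable] = borel_measurable_blinfun_eval[OF \<mu>]
  have A[measurable]: "A \<in> sets \<mu>"
    unfolding A_def by measurable
  have vanish: "blinfun_apply l (X \<omega>) = 0" if "l \<in> space \<mu>" "l \<notin> A" "\<omega> \<in> space M" for l \<omega>
  proof -
    have "closed {x. blinfun_apply l x = 0}"
      by (intro closed_Collect_eq continuous_intros)
    moreover have "range s \<subseteq> {x. blinfun_apply l x = 0}"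
      using that by (auto simp: A_def)
    ultimately have "closure (range s) \<subseteq> {x. blinfun_apply l x = 0}"
      by (rule closure_minimal[rotated])
    with range_X[OF that(3)] show ?thesis by auto
  qed
  have pairing[measurable]: "(\<lambda>(\<omega>, l). blinfun_apply l (X \<omega>)) \<in> borel_measurable (M \<Otimes>\<^sub>M \<mu>)"
    by (rule borel_measurable_pairing[OF \<mu> X range_X])
  have pairing_nn[measurable]: "(\<lambda>(\<omega>, l). ennreal \<bar>blinfun_apply l (X \<omega>)\<bar>) \<in> borel_measurable (M \<Otimes>\<^sub>M \<mu>)"
    by measurable
  have "sets (M \<Otimes>\<^sub>M ?\<nu>) = sets (M \<Otimes>\<^sub>M \<mu>)"
    by (intro sets_pair_measure_cong) auto
  then have pairing_\<nu>: "(\<lambda>(\<omega>, l). ennreal \<bar>blinfun_apply l (X \<omega>)\<bar>) \<in> borel_measurable (M \<Otimes>\<^sub>M ?\<nu>)"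
    using pairing_nn by (simp cong: measurable_cong_sets)
  have swapped: "(\<lambda>(l, \<omega>). ennreal \<bar>blinfun_apply l (X \<omega>)\<bar>) \<in> borel_measurable (\<mu> \<Otimes>\<^sub>M M)"
    using measurable_compose[OF measurable_pair_swap' pairing_nn] by (simp add: case_prod_beta')
  have "(\<integral>\<^sup>+ \<omega>. ennreal (norm (X \<omega>)) \<partial>M) = (\<integral>\<^sup>+ \<omega>. (\<integral>\<^sup>+ l. ennreal \<bar>blinfun_apply l (X \<omega>)\<bar> \<partial>?\<nu>) \<partial>M)"
    unfolding norm
    by (intro nn_integral_cong, subst nn_integral_density)
      (auto intro!: nn_integral_cong simp: vanish split: split_indicator)
  also have "\<dots> = (\<integral>\<^sup>+ l. (\<integral>\<^sup>+ \<omega>. ennreal \<bar>blinfun_apply l (X \<omega>)\<bar> \<partial>M) \<partial>?\<nu>)"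
    by (rule Fubini'[OF pairing_\<nu>, symmetric])
  also have "\<dots> = (\<integral>\<^sup>+ l. (\<integral>\<^sup>+ \<omega>. ennreal \<bar>blinfun_apply l (X \<omega>)\<bar> \<partial>M) \<partial>\<mu>)"
    using M.borel_measurable_nn_integral_fst[OF swapped]
    by (subst nn_integral_density)
      (auto intro!: nn_integral_cong nn_integral_zero' simp: vanish split: split_indicator)
  finally show ?thesis .
qed

section \<open>The expected norm in terms of the characteristic functional\<close>

lemma (in prob_space) expectation_one_minus_cos:
  fixes Y :: "'a \<Rightarrow> real"
  assumes [measurable]: "Y \<in> borel_measurable M"
  shows "(\<integral>\<^sup>+ \<omega>. ennreal ((1 - cos (t * Y \<omega>)) / t\<^sup>2) \<partial>M)
       = ennreal ((1 - Re (\<integral>\<omega>. exp (\<i> * of_real (t * Y \<omega>)) \<partial>M)) / t\<^sup>2)"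
proof -
  have exp_int: "integrable M (\<lambda>\<omega>. exp (\<i> * of_real (t * Y \<omega>)) :: complex)"
    by (rule integrable_const_bound[where B = 1]) auto
  have cos_int: "integrable M (\<lambda>\<omega>. cos (t * Y \<omega>))"
    by (rule integrable_const_bound[where B = 1]) auto
  have Re_exp: "Re (\<integral>\<omega>. exp (\<i> * of_real (t * Y \<omega>)) \<partial>M) = (\<integral>\<omega>. cos (t * Y \<omega>) \<partial>M)"
    using exp_int by (subst integral_Re[symmetric]) (auto simp: Re_exp)
  have "(\<integral>\<^sup>+ \<omega>. ennreal ((1 - cos (t * Y \<omega>)) / t\<^sup>2) \<partial>M)
      = ennreal (\<integral>\<omega>. (1 - cos (t * Y \<omega>)) / t\<^sup>2 \<partial>M)"
    using cos_int by (intro nn_integral_eq_integral) auto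
  also have "(\<integral>\<omega>. (1 - cos (t * Y \<omega>)) / t\<^sup>2 \<partial>M) = (1 - (\<integral>\<omega>. cos (t * Y \<omega>) \<partial>M)) / t\<^sup>2"
    using cos_int by (simp add: prob_space)
  finally show ?thesis
    unfolding Re_exp .
qed

text \<open>
  Two exchanges of integrals combine here: \<open>\<omega>\<close> with \<open>l\<close> by the previous section, and then, for
  fixed \<open>l\<close>, \<open>\<omega>\<close> with \<open>t\<close>, where both measures are \<sigma>-finite. The final passage from the
  iterated integral over \<open>l\<close> and \<open>t\<close> to the product measure asks \<sigma>-finiteness only of the inner
  measure \<open>dt\<close>, and joint measurability of the integrand, which is inherited from that
  of \<open>(\<omega>, l) \<mapsto> l (X \<omega>)\<close> by integrating out \<open>\<omega>\<close>.
\<close>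
lemma expected_norm_separable_range:
  fixes X :: "'w \<Rightarrow> 'v::real_normed_vector" and \<mu> :: "('v \<Rightarrow>\<^sub>L real) measure"
  assumes \<mu>: "sets \<mu> = sets borel"
    and norm: "\<And>x. ennreal (norm x) = (\<integral>\<^sup>+ l. ennreal \<bar>blinfun_apply l x\<bar> \<partial>\<mu>)"
    and M: "prob_space M"
    and X[measurable]: "X \<in> borel_measurable M"
    and range_X: "\<And>\<omega>. \<omega> \<in> space M \<Longrightarrow> X \<omega> \<in> closure (range (s :: nat \<Rightarrow> 'v))"
  shows "(\<integral>\<^sup>+ \<omega>. ennreal (norm (X \<omega>)) \<partial>M) =
    ennreal (2 / pi) *
    (\<integral>\<^sup>+ (l, t). ennreal
        ((1 - Re (\<integral>\<omega>. exp (\<i> * of_real (t * blinfun_apply l (X \<omega>))) \<partial>M)) / t\<^sup>2)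
      \<partial>(\<mu> \<Otimes>\<^sub>M restrict_space lborel {0<..}))"
proof -
  interpret prob_space M by (rule M)
  define T where "T = restrict_space lborel {0::real<..}"
  interpret T: sigma_finite_measure T
    unfolding T_def by (intro sigma_finite_measure_restrict_space sigma_finite_lborel) auto
  interpret MT: pair_sigma_finite M T ..
  have id_T[measurable]: "(\<lambda>t. t) \<in> borel_measurable T"
    unfolding T_def by (intro measurable_restrict_space1) simp
  have LX[measurable]: "(\<lambda>\<omega>. blinfun_apply l (X \<omega>)) \<in> borel_measurable M"
    for l :: "'v \<Rightarrow>\<^sub>L real"
    by (rule measurable_compose[OF X borel_measurable_blinfun_apply])
  let ?g = "\<lambda>l t \<omega>. ennreal ((1 - cos (t * blinfun_apply l (X \<omega>))) / t\<^sup>2)"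
  let ?h = "\<lambda>l t. ennreal
        ((1 - Re (\<integral>\<omega>. exp (\<i> * of_real (t * blinfun_apply l (X \<omega>))) \<partial>M)) / t\<^sup>2)"
  have h: "(\<integral>\<^sup>+ \<omega>. ?g l t \<omega> \<partial>M) = ?h l t" for l t
    by (rule expectation_one_minus_cos[OF LX])
  have joint: "(\<lambda>p. blinfun_apply (fst (fst p)) (X (snd p))) \<in> borel_measurable ((\<mu> \<Otimes>\<^sub>M T) \<Otimes>\<^sub>M M)"
  proof -
    have "(\<lambda>p. (snd p, fst (fst p))) \<in> measurable ((\<mu> \<Otimes>\<^sub>M T) \<Otimes>\<^sub>M M) (M \<Otimes>\<^sub>M \<mu>)"
      by measurable
    from measurable_compose[OF this borel_measurable_pairing[OF \<mu> X range_X]] show ?thesis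
      by simp
  qed
  have time: "(\<lambda>p. snd (fst p)) \<in> borel_measurable ((\<mu> \<Otimes>\<^sub>M T) \<Otimes>\<^sub>M M)"
    using measurable_compose[OF measurable_compose[OF measurable_fst measurable_snd] id_T] by simp
  have "(\<lambda>(p, \<omega>). ?g (fst p) (snd p) \<omega>) \<in> borel_measurable ((\<mu> \<Otimes>\<^sub>M T) \<Otimes>\<^sub>M M)"
    using joint time unfolding case_prod_beta' by measurable
  from borel_measurable_nn_integral_fst[OF this]
  have h_meas: "(\<lambda>(l, t). ?h l t) \<in> borel_measurable (\<mu> \<Otimes>\<^sub>M T)"
    by (simp add: h case_prod_beta')
  have inner: "(\<integral>\<^sup>+ \<omega>. ennreal \<bar>blinfun_apply l (X \<omega>)\<bar> \<partial>M) = ennreal (2 / pi) * (\<integral>\<^sup>+ t. ?h l t \<partial>T)" for l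
  proof -
    have g_meas: "(\<lambda>(\<omega>, t). ?g l t \<omega>) \<in> borel_measurable (M \<Otimes>\<^sub>M T)"
      by measurable
    have "(\<integral>\<^sup>+ \<omega>. ennreal \<bar>blinfun_apply l (X \<omega>)\<bar> \<partial>M)
        = (\<integral>\<^sup>+ \<omega>. ennreal (2 / pi) * (\<integral>\<^sup>+ t. ?g l t \<omega> \<partial>T) \<partial>M)"
      unfolding T_def by (intro nn_integral_cong nn_integral_one_minus_cos_over_square)
    also have "\<dots> = ennreal (2 / pi) * (\<integral>\<^sup>+ \<omega>. (\<integral>\<^sup>+ t. ?g l t \<omega> \<partial>T) \<partial>M)"
      using T.borel_measurable_nn_integral_fst[OF g_meas] by (intro nn_integral_cmult) simp
    also have "(\<integral>\<^sup>+ \<omega>. (\<integral>\<^sup>+ t. ?g l t \<omega> \<partial>T) \<partial>M) = (\<integral>\<^sup>+ t. ?h l t \<partial>T)"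
      using MT.Fubini'[OF g_meas] by (simp add: h)
    finally show ?thesis .
  qed
  have "(\<integral>\<^sup>+ \<omega>. ennreal (norm (X \<omega>)) \<partial>M) = (\<integral>\<^sup>+ l. ennreal (2 / pi) * (\<integral>\<^sup>+ t. ?h l t \<partial>T) \<partial>\<mu>)"
    by (simp add: nn_integral_norm_eq_iterated[OF \<mu> norm sigma_finite_measure_axioms X range_X] inner)
  also have "\<dots> = ennreal (2 / pi) * (\<integral>\<^sup>+ l. (\<integral>\<^sup>+ t. ?h l t \<partial>T) \<partial>\<mu>)"
    using T.borel_measurable_nn_integral_fst[OF h_meas] by (intro nn_integral_cmult) simp
  also have "(\<integral>\<^sup>+ l. (\<integral>\<^sup>+ t. ?h l t \<partial>T) \<partial>\<mu>) = (\<integral>\<^sup>+ (l, t). ?h l t \<partial>(\<mu> \<Otimes>\<^sub>M T))"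
    using T.nn_integral_fst[OF h_meas] by simp
  finally show ?thesis
    unfolding T_def .
qed

theorem corollary2p1:
  fixes \<mu> :: "('v::real_normed_vector \<Rightarrow>\<^sub>L real) measure"
    and M :: "'w measure"
    and X :: "'w \<Rightarrow> 'v"
  assumes "sets \<mu> = sets borel"
    and "\<And>x :: 'v. ennreal (norm x) = (\<integral>\<^sup>+ l. ennreal \<bar>blinfun_apply l x\<bar> \<partial>\<mu>)"
    and "prob_space M"
    and "random_vector M X"
  shows "(\<integral>\<^sup>+ \<omega>. ennreal (norm (X \<omega>)) \<partial>M) =
    ennreal (2 / pi) *
    (\<integral>\<^sup>+ (l, t). ennreal
        ((1 - Re (\<integral>\<omega>. exp (\<i> * of_real (t * blinfun_apply l (X \<omega>))) \<partial>M)) / t\<^sup>2)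
      \<partial>(\<mu> \<Otimes>\<^sub>M restrict_space lborel {0<..}))"
proof -
  from assms(4) obtain S where X[measurable]: "X \<in> borel_measurable M" and "countable S"
    and AE_S: "AE \<omega> in M. X \<omega> \<in> closure S"
    unfolding random_vector_def by blast
  define s where "s = from_nat_into (insert 0 S)"
  have range_s: "range s = insert 0 S"
    unfolding s_def using \<open>countable S\<close> by (intro range_from_nat_into) auto
  \<comment> \<open>Setting \<open>X\<close> to \<open>0\<close> on the null set where it leaves the closure of \<open>S\<close> changes neither side;
    adding \<open>0\<close> to \<open>S\<close> keeps the modified values in the closure.\<close>
  define X' where "X' \<omega> = (if X \<omega> \<in> closure S then X \<omega> else 0)" for \<omega>
  have X'[measurable]: "X' \<in> borel_measurable M"
    unfolding X'_def
  proof (rule measurable_If[OF X measurable_const])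
    show "{\<omega> \<in> space M. X \<omega> \<in> closure S} \<in> sets M"
      using measurable_sets[OF X borel_closed[OF closed_closure]]
      by (simp add: vimage_def Int_def conj_commute)
  qed simp
  have X'_range: "X' \<omega> \<in> closure (range s)" for \<omega>
    unfolding X'_def range_s
    using closure_mono[of S "insert 0 S"] closure_subset[of "insert 0 S"] by auto
  have AE_eq: "AE \<omega> in M. X \<omega> = X' \<omega>"
    using AE_S by eventually_elim (simp add: X'_def)
  have L: "(\<lambda>\<omega>. blinfun_apply l (X \<omega>)) \<in> borel_measurable M"
    "(\<lambda>\<omega>. blinfun_apply l (X' \<omega>)) \<in> borel_measurable M" for l :: "'v \<Rightarrow>\<^sub>L real"
    by (intro measurable_compose[OF X borel_measurable_blinfun_apply]
        measurable_compose[OF X' borel_measurable_blinfun_apply])+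
  have "(\<integral>\<^sup>+ \<omega>. ennreal (norm (X \<omega>)) \<partial>M) = (\<integral>\<^sup>+ \<omega>. ennreal (norm (X' \<omega>)) \<partial>M)"
    using AE_eq by (intro nn_integral_cong_AE) auto
  moreover have "(\<integral>\<omega>. exp (\<i> * of_real (t * blinfun_apply l (X \<omega>))) \<partial>M)
      = (\<integral>\<omega>. exp (\<i> * of_real (t * blinfun_apply l (X' \<omega>))) \<partial>M)" for l t
    using AE_eq L[of l] by (intro integral_cong_AE) auto
  ultimately show ?thesis
    using expected_norm_separable_range[OF assms(1-3) X' X'_range] by simp
qed

end
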